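(* Let $R$ be a unital ring with involution $*$ and let $a\in R$. The following assertions are equivalent: (i) $a$ is core invertible. (ii) There exists $x\in R$ such that $axa=a$, ${}^\circ x={}^\circ a$ and $x^\circ=(a^* )^\circ$. (iii) There exists $x\in R$ such that $axa=a$, $xax=x$, $(ax)^*=ax$, $xa^2=a$ and $ax^2=x$. (iv) There exist a self-adjoint idempotent $p\in R$ and an idempotent $q\in R$ such that $pR=aR$, $qR=aR$ and $Rq=Ra$. (v) $a$ is (von Neumann) regular and there exist a self-adjoint idempotent $p\in R$ and an idempotent $q\in R$ such that ${}^\circ a={}^\circ p$, ${}^\circ a={}^\circ q$ and $a^\circ=q^\circ$. If these assertions hold, then the core inverse $a^{\mathrm{core}}$ of $a$ is unique, any $x$ as in (ii) or as in (iii) equals $a^{\mathrm{core}}$, the pair $(p,q)$ in (iv) is unique, the pair $(p,q)$ in (v) is unique, and these two pairs coincide. Moreover, in this case the element $qa^{(1)}p$ does not depend on the choice of $a^{(1)}\in a\{1\}$, and $$a=\begin{bmatrix} a & 0 \\ 0 & 0 \end{bmatrix}_{p\times q},\qquad a^{\mathrm{core}}=\begin{bmatrix} qa^{(1)}p & 0 \\ 0 & 0 \end{bmatrix}_{q\times p}.$$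
   Context: For $a\in R$: $aR=\{ax:x\in R\}$, $Ra=\{xa:x\in R\}$, $a^\circ=\{x\in R: ax=0\}$, ${}^\circ a=\{x\in R: xa=0\}$. The element $a$ is regular if there is $x\in R$ with $axa=a$; $a\{1\}$ is the set of all such $x$, and $a^{(1)}$ denotes an arbitrary element of $a\{1\}$. A self-adjoint idempotent is $p$ with $p^2=p=p^*$. An element $x\in R$ is a core inverse of $a$ (denoted $a^{\mathrm{core}}$) if $axa=a$, $xR=aR$ and $Rx=Ra^*$; $a$ is core invertible if it has a core inverse. For idempotents $s,t\in R$, the notation $x=\begin{bmatrix} x_{11} & x_{12} \\ x_{21} & x_{22} \end{bmatrix}_{s\times t}$ means $x_{11}=sxt$, $x_{12}=sx(1-t)$, $x_{21}=(1-s)xt$, $x_{22}=(1-s)x(1-t)$ (so $x$ is the sum of the four entries). *)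

theory Defs
  imports Main
begin

text \<open>Unital rings with involution. The parent classes are \<^class>\<open>ring\<close> and \<^class>\<open>monoid_mult\<close>
  rather than \<^class>\<open>ring_1\<close>, because the latter excludes the zero ring.\<close>

class involution_ring = ring + monoid_mult +
  fixes star :: "'a \<Rightarrow> 'a"  ("_\<^sup>\<star>" [1000] 999)
  assumes star_star: "(x\<^sup>\<star>)\<^sup>\<star> = x"
    and star_add: "(x + y)\<^sup>\<star> = x\<^sup>\<star> + y\<^sup>\<star>"
    and star_mult: "(x * y)\<^sup>\<star> = y\<^sup>\<star> * x\<^sup>\<star>"

definition right_ideal_of :: "'a::times \<Rightarrow> 'a set" where
  "right_ideal_of a = {a * x | x. True}"

definition left_ideal_of :: "'a::times \<Rightarrow> 'a set" where
  "left_ideal_of a = {x * a | x. True}"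

definition right_annihilator :: "'a::{times,zero} \<Rightarrow> 'a set" where
  "right_annihilator a = {x. a * x = 0}"

definition left_annihilator :: "'a::{times,zero} \<Rightarrow> 'a set" where
  "left_annihilator a = {x. x * a = 0}"

definition inner_inverses :: "'a::times \<Rightarrow> 'a set" where
  "inner_inverses a = {x. a * x * a = a}"

definition regular :: "'a::times \<Rightarrow> bool" where
  "regular a \<longleftrightarrow> (\<exists>x. a * x * a = a)"

definition idempotent :: "'a::times \<Rightarrow> bool" where
  "idempotent q \<longleftrightarrow> q * q = q"

definition selfadjoint_idempotent :: "'a::involution_ring \<Rightarrow> bool" where
  "selfadjoint_idempotent p \<longleftrightarrow> idempotent p \<and> p\<^sup>\<star> = p"

definition is_core_inverse :: "'a::involution_ring \<Rightarrow> 'a \<Rightarrow> bool" where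
  "is_core_inverse a x \<longleftrightarrow>
     a * x * a = a \<and> right_ideal_of x = right_ideal_of a \<and> left_ideal_of x = left_ideal_of (a\<^sup>\<star>)"

definition core_invertible :: "'a::involution_ring \<Rightarrow> bool" where
  "core_invertible a \<longleftrightarrow> (\<exists>x. is_core_inverse a x)"

definition core_inverse :: "'a::involution_ring \<Rightarrow> 'a" where
  "core_inverse a = (THE x. is_core_inverse a x)"

definition annihilator_core_conditions :: "'a::involution_ring \<Rightarrow> 'a \<Rightarrow> bool" where
  "annihilator_core_conditions a x \<longleftrightarrow>
     a * x * a = a \<and> left_annihilator x = left_annihilator a \<and>
     right_annihilator x = right_annihilator (a\<^sup>\<star>)"

definition core_equations :: "'a::involution_ring \<Rightarrow> 'a \<Rightarrow> bool" where
  "core_equations a x \<longleftrightarrow>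
     a * x * a = a \<and> x * a * x = x \<and> (a * x)\<^sup>\<star> = a * x \<and> x * a\<^sup>2 = a \<and> a * x\<^sup>2 = x"

definition ideal_core_pair :: "'a::involution_ring \<Rightarrow> 'a \<Rightarrow> 'a \<Rightarrow> bool" where
  "ideal_core_pair a p q \<longleftrightarrow>
     selfadjoint_idempotent p \<and> idempotent q \<and>
     right_ideal_of p = right_ideal_of a \<and>
     right_ideal_of q = right_ideal_of a \<and> left_ideal_of q = left_ideal_of a"

definition annihilator_core_pair :: "'a::involution_ring \<Rightarrow> 'a \<Rightarrow> 'a \<Rightarrow> bool" where
  "annihilator_core_pair a p q \<longleftrightarrow>
     selfadjoint_idempotent p \<and> idempotent q \<and>
     left_annihilator a = left_annihilator p \<and>
     left_annihilator a = left_annihilator q \<and> right_annihilator a = right_annihilator q"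

text \<open>\<open>has_block_form s t x x11 x12 x21 x22\<close> expresses that \<open>x\<close> is the 2-by-2 matrix with rows
  \<open>(x11, x12)\<close> and \<open>(x21, x22)\<close> with respect to the idempotents \<open>s\<close> (rows) and \<open>t\<close> (columns);
  \<open>x\<close> is then the sum of the four entries.\<close>

definition has_block_form ::
    "'a::{ring,monoid_mult} \<Rightarrow> 'a \<Rightarrow> 'a \<Rightarrow> 'a \<Rightarrow> 'a \<Rightarrow> 'a \<Rightarrow> 'a \<Rightarrow> bool" where
  "has_block_form s t x x11 x12 x21 x22 \<longleftrightarrow>
     idempotent s \<and> idempotent t \<and>
     x11 = s * x * t \<and> x12 = s * x * (1 - t) \<and>
     x21 = (1 - s) * x * t \<and> x22 = (1 - s) * x * (1 - t)"

end

theory Submission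
  imports Defs
begin

text \<open>Conditions (i), (ii) and (iii) are satisfied by exactly the same elements \<open>x\<close>. A projection is
  determined by its range, so \<open>a * x\<close>, and with it \<open>x = x * (a * x)\<close>, is unique. Any pair in (iv)
  or (v) is \<open>(a * x, x * a)\<close>, because \<open>x = q * y * p\<close> solves the equations in (iii) with
  \<open>a * x = p\<close> and \<open>x * a = q\<close> for every inner inverse \<open>y\<close> of \<open>a\<close>.\<close>

section \<open>Principal ideals and annihilators\<close>

text \<open>Because of the unit, each generator lies in its own ideal, so equality of ideals amounts
  to mutual divisibility, with witnesses to calculate with.\<close>

lemma right_ideal_of_eq_iff:
  fixes a b :: "'a::monoid_mult"
  shows "right_ideal_of a = right_ideal_of b \<longleftrightarrow> (\<exists>u. a = b * u) \<and> (\<exists>v. b = a * v)"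
proof
  assume eq: "right_ideal_of a = right_ideal_of b"
  have "a \<in> right_ideal_of a" "b \<in> right_ideal_of b"
    unfolding right_ideal_of_def by (metis (mono_tags) mem_Collect_eq mult_1_right)+
  with eq have "a \<in> right_ideal_of b" "b \<in> right_ideal_of a"
    by simp_all
  then show "(\<exists>u. a = b * u) \<and> (\<exists>v. b = a * v)"
    unfolding right_ideal_of_def by blast
next
  assume "(\<exists>u. a = b * u) \<and> (\<exists>v. b = a * v)"
  then show "right_ideal_of a = right_ideal_of b"
    unfolding right_ideal_of_def by (auto; metis mult.assoc)
qed

lemma left_ideal_of_eq_iff:
  fixes a b :: "'a::monoid_mult"
  shows "left_ideal_of a = left_ideal_of b \<longleftrightarrow> (\<exists>u. a = u * b) \<and> (\<exists>v. b = v * a)"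
proof
  assume eq: "left_ideal_of a = left_ideal_of b"
  have "a \<in> left_ideal_of a" "b \<in> left_ideal_of b"
    unfolding left_ideal_of_def by (metis (mono_tags) mem_Collect_eq mult_1_left)+
  with eq have "a \<in> left_ideal_of b" "b \<in> left_ideal_of a"
    by simp_all
  then show "(\<exists>u. a = u * b) \<and> (\<exists>v. b = v * a)"
    unfolding left_ideal_of_def by blast
next
  assume "(\<exists>u. a = u * b) \<and> (\<exists>v. b = v * a)"
  then show "left_ideal_of a = left_ideal_of b"
    unfolding left_ideal_of_def by (auto; metis mult.assoc)
qed

lemma left_annihilator_eq_if_right_ideal_of_eq:
  fixes a b :: "'a::{ring,monoid_mult}"
  assumes "right_ideal_of a = right_ideal_of b"
  shows "left_annihilator a = left_annihilator b"
proof -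
  obtain u v where "a = b * u" "b = a * v"
    using assms unfolding right_ideal_of_eq_iff by blast
  then show ?thesis
    unfolding left_annihilator_def by (metis mult.assoc mult_zero_left)
qed

lemma right_annihilator_eq_if_left_ideal_of_eq:
  fixes a b :: "'a::{ring,monoid_mult}"
  assumes "left_ideal_of a = left_ideal_of b"
  shows "right_annihilator a = right_annihilator b"
proof -
  obtain u v where "a = u * b" "b = v * a"
    using assms unfolding left_ideal_of_eq_iff by blast
  then show ?thesis
    unfolding right_annihilator_def by (metis mult.assoc mult_zero_right)
qed

text \<open>\<open>c * a = a\<close> says that \<open>c - 1\<close> annihilates \<open>a\<close>
  from the left. This carries identities from one element to another where no divisibility witnesses
  are at hand.\<close>

lemma left_annihilator_transfer:
  fixes a b :: "'a::{ring,monoid_mult}"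
  assumes "left_annihilator a = left_annihilator b" and "c * a = a"
  shows "c * b = b"
proof -
  have "c - 1 \<in> left_annihilator a"
    using assms(2) by (simp add: left_annihilator_def left_diff_distrib)
  then have "c - 1 \<in> left_annihilator b"
    using assms(1) by simp
  then show ?thesis
    by (simp add: left_annihilator_def left_diff_distrib)
qed

lemma right_annihilator_transfer:
  fixes a b :: "'a::{ring,monoid_mult}"
  assumes "right_annihilator a = right_annihilator b" and "a * c = a"
  shows "b * c = b"
proof -
  have "c - 1 \<in> right_annihilator a"
    using assms(2) by (simp add: right_annihilator_def right_diff_distrib)
  then have "c - 1 \<in> right_annihilator b"
    using assms(1) by simp
  then show ?thesis
    by (simp add: right_annihilator_def right_diff_distrib)
qed

section \<open>Equivalent descriptions of the core inverse\<close>

lemma core_equationsD: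
  assumes "core_equations a x"
  shows "a * x * a = a" and "x * a * x = x" and "(a * x)\<^sup>\<star> = a * x"
    and "x * (a * a) = a" and "a * (x * x) = x"
  using assms unfolding core_equations_def power2_eq_square by auto

text \<open>Self-adjointness of \<open>a * x\<close> brings in \<open>a\<^sup>\<star>\<close>:
  starring \<open>a * x\<close> inside \<open>x = x * (a * x)\<close>, and starring
  \<open>a = a * x * a\<close>, give the two left divisibilities. The right ones are the last two
  equations.\<close>

lemma core_equations_imp_is_core_inverse:
  assumes "core_equations a x"
  shows "is_core_inverse a x"
proof -
  note eqs = core_equationsD[OF assms]
  have "x = x * x\<^sup>\<star> * a\<^sup>\<star>"
    using eqs(2,3) by (simp add: star_mult mult.assoc)
  moreover have "a\<^sup>\<star> = a\<^sup>\<star> * a * x"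
    using eqs(1,3) by (metis mult.assoc star_mult)
  moreover have "x = a * (x * x)" "a = x * (a * a)"
    using eqs(4,5) by simp_all
  ultimately show ?thesis
    unfolding is_core_inverse_def right_ideal_of_eq_iff left_ideal_of_eq_iff
    using eqs(1) by blast
qed

lemma is_core_inverse_imp_annihilator_core_conditions:
  assumes "is_core_inverse a x"
  shows "annihilator_core_conditions a x"
  using assms left_annihilator_eq_if_right_ideal_of_eq right_annihilator_eq_if_left_ideal_of_eq
  unfolding is_core_inverse_def annihilator_core_conditions_def by blast

lemma annihilator_core_conditions_imp_core_equations:
  assumes "annihilator_core_conditions a x"
  shows "core_equations a x"
proof -
  have axa: "a * x * a = a" and left: "left_annihilator a = left_annihilator x"
    and right: "right_annihilator (a\<^sup>\<star>) = right_annihilator x"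
    using assms unfolding annihilator_core_conditions_def by auto
  have axx: "a * x * x = x"
    by (rule left_annihilator_transfer[OF left axa])
  \<comment> \<open>Starring \<open>a * x * a = a\<close> yields a right multiplier fixing
    \<open>a\<^sup>\<star>\<close>, which therefore fixes \<open>x\<close> too.\<close>
  have "a\<^sup>\<star> * (a * x)\<^sup>\<star> = a\<^sup>\<star>"
    by (metis axa star_mult)
  then have x_star: "x * (a * x)\<^sup>\<star> = x"
    by (rule right_annihilator_transfer[OF right])
  then have "a * x * (a * x)\<^sup>\<star> = a * x"
    by (simp add: mult.assoc)
  \<comment> \<open>An element of the form \<open>b * b\<^sup>\<star>\<close> is self-adjoint; here
    it equals \<open>b = a * x\<close>.\<close>
  then have sa: "(a * x)\<^sup>\<star> = a * x"
    by (metis star_mult star_star)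
  then have xax: "x * a * x = x"
    using x_star by (simp add: mult.assoc)
  have "x * a * a = a"
    by (rule left_annihilator_transfer[OF left[symmetric] xax])
  then show ?thesis
    unfolding core_equations_def power2_eq_square
    using axa axx sa xax by (simp add: mult.assoc)
qed

lemma is_core_inverse_iff_core_equations: "is_core_inverse a x \<longleftrightarrow> core_equations a x"
  and annihilator_core_conditions_iff_core_equations:
    "annihilator_core_conditions a x \<longleftrightarrow> core_equations a x"
  using core_equations_imp_is_core_inverse is_core_inverse_imp_annihilator_core_conditions
    annihilator_core_conditions_imp_core_equations by blast+

section \<open>Uniqueness of the core inverse\<close>

lemma core_equations_unique:
  assumes "core_equations a x" and "core_equations a y"
  shows "x = y"
proof -
  note x = core_equationsD[OF assms(1)] and y = core_equationsD[OF assms(2)]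
  \<comment> \<open>\<open>a * y\<close> fixes \<open>a\<close> from the left, hence also
    \<open>a * x\<close>. Starring swaps the two projections, and then \<open>a * x\<close> is
    absorbed in the same way.\<close>
  have "a * x = (a * y * (a * x))\<^sup>\<star>"
    using x(3) y(1) by (metis mult.assoc)
  also have "\<dots> = a * x * (a * y)"
    by (simp only: star_mult[of "a * y"] x(3) y(3))
  also have "\<dots> = a * y"
    using x(1) by (metis mult.assoc)
  finally have "x = x * (a * y)"
    using x(2) by (metis mult.assoc)
  \<comment> \<open>Expanding \<open>y\<close> as \<open>a * (y * y)\<close> creates the factor
    \<open>a * a\<close> on which \<open>x * (a * a) = a\<close> acts.\<close>
  also have "\<dots> = x * (a * a) * (y * y)"
    using y(5) by (metis mult.assoc)
  also have "\<dots> = y"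
    using x(4) y(5) by simp
  finally show ?thesis .
qed

lemma core_equations_imp_core_inverse:
  assumes "core_equations a x"
  shows "core_inverse a = x"
  unfolding core_inverse_def is_core_inverse_iff_core_equations
  using assms core_equations_unique by blast

section \<open>Pairs of idempotents attached to the core inverse\<close>

lemma core_equations_imp_ideal_core_pair:
  assumes "core_equations a x"
  shows "ideal_core_pair a (a * x) (x * a)"
proof -
  note eqs = core_equationsD[OF assms]
  have "a * x * (a * x) = a * x" "x * a * (x * a) = x * a" "x * a = a * (x * x * a)"
    using eqs by (metis mult.assoc)+
  moreover have "a = a * x * a" "a = x * a * a" "a = a * (x * a)"
    using eqs(1,4) by (simp_all add: mult.assoc)
  ultimately show ?thesis
    unfolding ideal_core_pair_def selfadjoint_idempotent_def idempotent_def
      right_ideal_of_eq_iff left_ideal_of_eq_iff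
    using eqs(3) by blast
qed

lemma ideal_core_pair_imp_annihilator_core_pair:
  assumes "ideal_core_pair a p q"
  shows "annihilator_core_pair a p q"
proof -
  have "left_annihilator p = left_annihilator a" "left_annihilator q = left_annihilator a"
    "right_annihilator q = right_annihilator a"
    using assms left_annihilator_eq_if_right_ideal_of_eq right_annihilator_eq_if_left_ideal_of_eq
    unfolding ideal_core_pair_def by blast+
  then show ?thesis
    using assms unfolding ideal_core_pair_def annihilator_core_pair_def by simp
qed

text \<open>With \<open>q = y * a\<close> and \<open>a = z * q\<close>, idempotency gives
  \<open>a * y * a = a * q = z * q * q = a\<close>.\<close>

lemma ideal_core_pair_imp_regular:
  assumes "ideal_core_pair a p q"
  shows "regular a"
proof -
  obtain y z where "q * q = q" "q = y * a" "a = z * q"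
    using assms unfolding ideal_core_pair_def idempotent_def left_ideal_of_eq_iff by blast
  then have "a * y * a = a"
    by (metis mult.assoc)
  then show ?thesis
    unfolding regular_def by blast
qed

text \<open>Regularity enters through an arbitrary \<open>y\<close>; the pair corrects it to
  \<open>q * y * p\<close>, whose products with \<open>a\<close> on either side are the given
  idempotents.\<close>

lemma annihilator_core_pair_core_equations:
  assumes pair: "annihilator_core_pair a p q" and inner: "a * y * a = a"
  shows "core_equations a (q * y * p)" and "a * (q * y * p) = p" and "q * y * p * a = q"
proof -
  have idem: "p * p = p" "q * q = q" and sa: "p\<^sup>\<star> = p"
    and lp: "left_annihilator a = left_annihilator p"
    and lq: "left_annihilator a = left_annihilator q"
    and rq: "right_annihilator a = right_annihilator q"
    using pair unfolding annihilator_core_pair_def selfadjoint_idempotent_def idempotent_def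
    by auto
  \<comment> \<open>Each of these identities says that some element is fixed by a factor, and is
    transferred from another element with the same annihilator.\<close>
  have pa: "p * a = a"
    using left_annihilator_transfer[OF lp[symmetric] idem(1)] .
  have qa: "q * a = a"
    using left_annihilator_transfer[OF lq[symmetric] idem(2)] .
  have aq: "a * q = a"
    using right_annihilator_transfer[OF rq[symmetric] idem(2)] .
  have ayp: "a * y * p = p"
    using left_annihilator_transfer[OF lp inner] .
  have qya: "q * (y * a) = q"
    using right_annihilator_transfer[OF rq] inner by (simp add: mult.assoc)
  have pq: "p * q = q"
    using left_annihilator_transfer[OF lq pa] .
  show ax: "a * (q * y * p) = p"
    using aq ayp by (metis mult.assoc)
  show xa: "q * y * p * a = q"
    using pa qya by (simp add: mult.assoc)
  have "a * (q * y * p) * a = a"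
    using ax pa by simp
  moreover have "q * y * p * a * (q * y * p) = q * y * p"
    using xa idem by (metis mult.assoc)
  moreover have "(q * y * p) * a\<^sup>2 = a"
    using xa qa by (metis mult.assoc power2_eq_square)
  \<comment> \<open>One factor is absorbed into \<open>a * (q * y * p) = p\<close>, and the
    remaining \<open>p\<close> disappears by \<open>p * q = q\<close>.\<close>
  moreover have "a * (q * y * p)\<^sup>2 = q * y * p"
    using ax pq by (metis mult.assoc power2_eq_square)
  ultimately show "core_equations a (q * y * p)"
    unfolding core_equations_def using ax sa by simp
qed

text \<open>Here \<open>x\<close> itself serves as the inner inverse: uniqueness gives
  \<open>q * x * p = x\<close>, so both idempotents can be read off. The equivalence yields
  existence and uniqueness of the pair at once.\<close>

lemma annihilator_core_pair_iff:
  assumes "core_equations a x"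
  shows "annihilator_core_pair a p q \<longleftrightarrow> p = a * x \<and> q = x * a"
proof
  assume "annihilator_core_pair a p q"
  note * = annihilator_core_pair_core_equations[OF this core_equationsD(1)[OF assms]]
  have "q * x * p = x"
    using core_equations_unique[OF *(1) assms] .
  with *(2,3) show "p = a * x \<and> q = x * a"
    by simp
next
  assume "p = a * x \<and> q = x * a"
  then show "annihilator_core_pair a p q"
    using core_equations_imp_ideal_core_pair[OF assms] ideal_core_pair_imp_annihilator_core_pair
    by blast
qed

lemma ideal_core_pair_iff:
  assumes "core_equations a x"
  shows "ideal_core_pair a p q \<longleftrightarrow> p = a * x \<and> q = x * a"
  using annihilator_core_pair_iff[OF assms] core_equations_imp_ideal_core_pair[OF assms]
    ideal_core_pair_imp_annihilator_core_pair by blast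

section \<open>Block forms and assembly of the theorem\<close>

text \<open>For \<open>p = a * x\<close> and \<open>q = x * a\<close>, the inner inverse in
  \<open>q * y * p\<close> occurs only within \<open>a * y * a = a\<close>, hence independence of
  its choice.\<close>

lemma core_equations_middle_inner_inverse:
  assumes "core_equations a x" and "y \<in> inner_inverses a"
  shows "x * a * y * (a * x) = x"
proof -
  have "x * a * y * (a * x) = x * (a * y * a) * x"
    by (simp add: mult.assoc)
  also have "\<dots> = x"
    using assms core_equationsD(2) by (simp add: inner_inverses_def)
  finally show ?thesis .
qed

text \<open>The complements \<open>1 - s\<close> and \<open>1 - t\<close> annihilate
  \<open>x\<close> from the left and from the right.\<close>

lemma has_block_form_corner:
  fixes x :: "'a::{ring,monoid_mult}"
  assumes "idempotent s" "idempotent t" "s * x = x" "x * t = x"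
  shows "has_block_form s t x x 0 0 0"
  using assms by (simp add: has_block_form_def left_diff_distrib right_diff_distrib)

theorem theorem2p14:
  fixes a :: "'a::involution_ring"
  shows
    "(core_invertible a \<longleftrightarrow> (\<exists>x. annihilator_core_conditions a x)) \<and>
     (core_invertible a \<longleftrightarrow> (\<exists>x. core_equations a x)) \<and>
     (core_invertible a \<longleftrightarrow> (\<exists>p q. ideal_core_pair a p q)) \<and>
     (core_invertible a \<longleftrightarrow> regular a \<and> (\<exists>p q. annihilator_core_pair a p q)) \<and>
     (core_invertible a \<longrightarrow>
        (\<exists>!x. is_core_inverse a x) \<and>
        (\<forall>x. annihilator_core_conditions a x \<longrightarrow> x = core_inverse a) \<and>
        (\<forall>x. core_equations a x \<longrightarrow> x = core_inverse a) \<and>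
        (\<exists>p q.
           (\<forall>p' q'. ideal_core_pair a p' q' \<longleftrightarrow> p' = p \<and> q' = q) \<and>
           (\<forall>p' q'. annihilator_core_pair a p' q' \<longleftrightarrow> p' = p \<and> q' = q) \<and>
           (\<forall>y\<in>inner_inverses a. \<forall>z\<in>inner_inverses a. q * y * p = q * z * p) \<and>
           has_block_form p q a a 0 0 0 \<and>
           (\<forall>y\<in>inner_inverses a. has_block_form q p (core_inverse a) (q * y * p) 0 0 0)))"
proof -
  have i_iii: "core_invertible a \<longleftrightarrow> (\<exists>x. core_equations a x)"
    unfolding core_invertible_def is_core_inverse_iff_core_equations ..
  \<comment> \<open>A cycle: the equations give an ideal pair, this gives regularity and an
    annihilator pair, and these with any inner inverse solve the equations again.\<close>
  have iv: "core_invertible a \<longleftrightarrow> (\<exists>p q. ideal_core_pair a p q)"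
    and v: "core_invertible a \<longleftrightarrow> regular a \<and> (\<exists>p q. annihilator_core_pair a p q)"
    unfolding i_iii
    using core_equations_imp_ideal_core_pair ideal_core_pair_imp_annihilator_core_pair
      ideal_core_pair_imp_regular annihilator_core_pair_core_equations(1)
    unfolding regular_def by blast+
  have rest: "(\<exists>!x. is_core_inverse a x) \<and>
        (\<forall>x. annihilator_core_conditions a x \<longrightarrow> x = core_inverse a) \<and>
        (\<forall>x. core_equations a x \<longrightarrow> x = core_inverse a) \<and>
        (\<exists>p q.
           (\<forall>p' q'. ideal_core_pair a p' q' \<longleftrightarrow> p' = p \<and> q' = q) \<and>
           (\<forall>p' q'. annihilator_core_pair a p' q' \<longleftrightarrow> p' = p \<and> q' = q) \<and>
           (\<forall>y\<in>inner_inverses a. \<forall>z\<in>inner_inverses a. q * y * p = q * z * p) \<and>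
           has_block_form p q a a 0 0 0 \<and>
           (\<forall>y\<in>inner_inverses a. has_block_form q p (core_inverse a) (q * y * p) 0 0 0))"
    if x: "core_equations a x" for x
  proof (intro conjI)
    note eqs = core_equationsD[OF x]
    have idem: "idempotent (a * x)" "idempotent (x * a)"
      using eqs(1,2) by (simp_all add: idempotent_def mult.assoc[symmetric])
    show "\<exists>!x. is_core_inverse a x"
      unfolding is_core_inverse_iff_core_equations using x core_equations_unique by blast
    show "\<forall>x. annihilator_core_conditions a x \<longrightarrow> x = core_inverse a"
      "\<forall>x. core_equations a x \<longrightarrow> x = core_inverse a"
      using core_equations_imp_core_inverse
      by (auto simp: annihilator_core_conditions_iff_core_equations)
    \<comment> \<open>The corner conditions are \<open>a * x * a = a\<close> and
      \<open>x * a * x = x\<close>, each read with both bracketings.\<close>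
    have "has_block_form (a * x) (x * a) a a 0 0 0" "has_block_form (x * a) (a * x) x x 0 0 0"
      using eqs(1,2) by (simp_all add: has_block_form_corner idem mult.assoc)
    then show "\<exists>p q.
           (\<forall>p' q'. ideal_core_pair a p' q' \<longleftrightarrow> p' = p \<and> q' = q) \<and>
           (\<forall>p' q'. annihilator_core_pair a p' q' \<longleftrightarrow> p' = p \<and> q' = q) \<and>
           (\<forall>y\<in>inner_inverses a. \<forall>z\<in>inner_inverses a. q * y * p = q * z * p) \<and>
           has_block_form p q a a 0 0 0 \<and>
           (\<forall>y\<in>inner_inverses a. has_block_form q p (core_inverse a) (q * y * p) 0 0 0)"
      by - (rule exI[of _ "a * x"], rule exI[of _ "x * a"],
          simp add: ideal_core_pair_iff[OF x] annihilator_core_pair_iff[OF x]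
          core_equations_middle_inner_inverse[OF x] core_equations_imp_core_inverse[OF x])
  qed
  show ?thesis
    unfolding annihilator_core_conditions_iff_core_equations
    using i_iii iv v rest[unfolded annihilator_core_conditions_iff_core_equations] by blast
qed

end
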